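(* If items in $V$ can be used multiple times in the output sequence, then the greedy algorithm yields a 2-approximation for the function-arriving maximum submodular ranking problem (MSR-F). That is, for every instance of MSR-F, if $\sigma$ is any sequence produced by the greedy algorithm and $\mathrm{OPT}$ is the maximum of $\sum_t\sum_{f\in\mathcal{F}_t} f(\sigma^*[t:k(f)])$ over all sequences $\sigma^*$ of items of $V$ (repetitions allowed), then $$\sum_t\sum_{f\in\mathcal{F}_t} f(\sigma[t:k(f)])\ \ge\ \tfrac12\,\mathrm{OPT}.$$
   Context: For a finite set $V$, a function $f:2^V\to\mathbb{R}_+$ is submodular if $f(v\mid Y)\le f(v\mid X)$ for all $X\subseteq Y\subseteq V$ and $v\in V\setminus Y$, where $f(v\mid Y)=f(Y\cup\{v\})-f(Y)$; it is non-decreasing if $f(X)\le f(Y)$ whenever $X\subseteq Y$. MSR-F (repetitions allowed): given is a finite nonempty set $V$ of items. At the beginning of each step $t=1,2,\dots$, a finite (possibly empty) collection $\mathcal{F}_t$ of non-decreasing submodular functions $f:2^V\to\mathbb{R}_+$ arrives; each $f\in\mathcal{F}_t$ has arrival time $\tau(f)=t$ and comes with an integer $k(f)$. The total number of functions is finite. After seeing $\mathcal{F}_t$, one irrevocably decides the $t$-th item $\sigma_t\in V$ of the output sequence $\sigma$. For integers $s,e$, $\sigma[s:e]=\{\sigma_s,\dots,\sigma_e\}$ as a set of items (empty if $e<s$). The objective, to be maximized, is $\sum_t\sum_{f\in\mathcal{F}_t} f(\sigma[t:k(f)])$. Greedy algorithm: at each step $t=1,2,\dots$ (running at least until every $k(f)$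 is passed), let $A_t=\{f\in\mathcal{F}_1\cup\dots\cup\mathcal{F}_t : k(f)\ge t\}$ be the set of active functions, and set $$\sigma_t\in\arg\max_{v\in V}\ \sum_{f\in A_t} f\big(v\mid \sigma[\tau(f):t-1]\big),$$ with ties broken arbitrarily. *)

theory Defs
  imports Complex_Main "HOL-Library.FuncSet"
begin

definition marginal :: "('a set \<Rightarrow> real) \<Rightarrow> 'a \<Rightarrow> 'a set \<Rightarrow> real" where
  "marginal f v Y = f (Y \<union> {v}) - f Y"

definition submodular_on :: "'a set \<Rightarrow> ('a set \<Rightarrow> real) \<Rightarrow> bool" where
  "submodular_on V f \<longleftrightarrow>
     (\<forall>X Y v. X \<subseteq> Y \<and> Y \<subseteq> V \<and> v \<in> V - Y \<longrightarrow> marginal f v Y \<le> marginal f v X)"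

text \<open>
  The arriving functions are given by labels, so that one set function may arrive several times,
  at equal or different steps and with equal or different deadlines. Of \<open>val I f\<close> only the
  restriction to the subsets of \<open>items I\<close> matters. The deadline of \<open>f\<close> is the integer \<open>k(f)\<close>,
  which may precede the arrival time.
\<close>

record ('a, 'f) msr_instance =
  items :: "'a set"
  funs :: "'f set"
  val :: "'f \<Rightarrow> 'a set \<Rightarrow> real"
  arrival :: "'f \<Rightarrow> nat"
  deadline :: "'f \<Rightarrow> int"

definition msr_f :: "('a, 'f) msr_instance \<Rightarrow> bool" where
  "msr_f I \<longleftrightarrow>
     finite (items I) \<and> items I \<noteq> {} \<and> finite (funs I) \<and>
     (\<forall>f\<in>funs I.
        arrival I f \<ge> 1 \<and>
        (\<forall>X. X \<subseteq> items I \<longrightarrow> 0 \<le> val I f X) \<and>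
        mono_on (Pow (items I)) (val I f) \<and>
        submodular_on (items I) (val I f))"

definition arriving :: "('a, 'f) msr_instance \<Rightarrow> nat \<Rightarrow> 'f set" where
  "arriving I t = {f \<in> funs I. arrival I f = t}"

definition active :: "('a, 'f) msr_instance \<Rightarrow> nat \<Rightarrow> 'f set" where
  "active I t = {f \<in> (\<Union>s\<in>{1..t}. arriving I s). deadline I f \<ge> int t}"

text \<open>
  An output sequence is a function on \<^typ>\<open>nat\<close> whose values at the steps \<open>1, 2, \<dots>\<close> count;
  its value at \<open>0\<close> is never used.
\<close>

definition item_sequence :: "('a, 'f) msr_instance \<Rightarrow> (nat \<Rightarrow> 'a) \<Rightarrow> bool" where
  "item_sequence I \<sigma> \<longleftrightarrow> (\<forall>t\<ge>1. \<sigma> t \<in> items I)"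

definition segment :: "(nat \<Rightarrow> 'a) \<Rightarrow> int \<Rightarrow> int \<Rightarrow> 'a set" where
  "segment \<sigma> s e = \<sigma> ` {i. 1 \<le> i \<and> s \<le> int i \<and> int i \<le> e}"

text \<open>Only the steps in \<open>arrival I ` funs I\<close> contribute to the sum over all steps.\<close>

definition objective :: "('a, 'f) msr_instance \<Rightarrow> (nat \<Rightarrow> 'a) \<Rightarrow> real" where
  "objective I \<sigma> =
     (\<Sum>t\<in>arrival I ` funs I. \<Sum>f\<in>arriving I t. val I f (segment \<sigma> (int t) (deadline I f)))"

definition OPT :: "('a, 'f) msr_instance \<Rightarrow> real" where
  "OPT I = Max {objective I \<sigma> |\<sigma>. item_sequence I \<sigma>}"

definition gain :: "('a, 'f) msr_instance \<Rightarrow> (nat \<Rightarrow> 'a) \<Rightarrow> nat \<Rightarrow> 'a \<Rightarrow> real" where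
  "gain I \<sigma> t v =
     (\<Sum>f\<in>active I t. marginal (val I f) v (segment \<sigma> (int (arrival I f)) (int t - 1)))"

text \<open>
  The greedy algorithm may stop once all deadlines have passed. From then on no function is
  active, so every item attains the maximum gain \<open>0\<close>; hence the outputs of all greedy runs are
  the prefixes of the infinite sequences below, and the rest does not affect the objective.
\<close>

definition greedy_sequence :: "('a, 'f) msr_instance \<Rightarrow> (nat \<Rightarrow> 'a) \<Rightarrow> bool" where
  "greedy_sequence I \<sigma> \<longleftrightarrow>
     (\<forall>t\<ge>1. is_arg_max (gain I \<sigma> t) (\<lambda>v. v \<in> items I) (\<sigma> t))"

text \<open>The maximum in \<^const>\<open>OPT\<close> is over a finite nonempty set, hence attained.\<close>

lemma finite_objective_values:
  assumes "msr_f I"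
  shows "finite {objective I \<sigma> |\<sigma>. item_sequence I \<sigma>}"
proof -
  define N where "N = nat (Max (insert 0 (deadline I ` funs I)))"
  have fin: "finite (funs I)" using assms by (simp add: msr_f_def)
  have N: "deadline I f \<le> int N" if "f \<in> funs I" for f
  proof -
    have "deadline I f \<le> Max (insert 0 (deadline I ` funs I))"
      using fin that by (intro Max_ge) auto
    then show ?thesis by (simp add: N_def)
  qed
  have eq: "objective I \<sigma> = objective I (restrict \<sigma> {1..N})" for \<sigma>
    unfolding objective_def
  proof (intro sum.cong refl)
    fix t f assume "f \<in> arriving I t"
    then have "deadline I f \<le> int N" using N by (simp add: arriving_def)
    then have "segment \<sigma> (int t) (deadline I f) = segment (restrict \<sigma> {1..N}) (int t) (deadline I f)"
      unfolding segment_def by (intro image_cong refl) auto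
    then show "val I f (segment \<sigma> (int t) (deadline I f))
        = val I f (segment (restrict \<sigma> {1..N}) (int t) (deadline I f))" by simp
  qed
  have "{objective I \<sigma> |\<sigma>. item_sequence I \<sigma>} \<subseteq> objective I ` (PiE {1..N} (\<lambda>_. items I))"
  proof clarify
    fix \<sigma> assume "item_sequence I \<sigma>"
    then have "restrict \<sigma> {1..N} \<in> PiE {1..N} (\<lambda>_. items I)"
      by (auto simp: item_sequence_def)
    then show "objective I \<sigma> \<in> objective I ` (PiE {1..N} (\<lambda>_. items I))"
      using eq by blast
  qed
  moreover have "finite (PiE {1..N} (\<lambda>_. items I))"
    using assms by (intro finite_PiE) (auto simp: msr_f_def)
  ultimately show ?thesis by (meson finite_imageI finite_subset)
qed

lemma OPT_attained:
  assumes "msr_f I"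
  shows "\<exists>\<sigma>. item_sequence I \<sigma> \<and> objective I \<sigma> = OPT I"
    and "item_sequence I \<sigma>' \<Longrightarrow> objective I \<sigma>' \<le> OPT I"
proof -
  let ?S = "{objective I \<sigma> |\<sigma>. item_sequence I \<sigma>}"
  obtain v where "v \<in> items I" using assms by (auto simp: msr_f_def)
  then have "item_sequence I (\<lambda>_. v)" by (simp add: item_sequence_def)
  then have "?S \<noteq> {}" by blast
  then have "OPT I \<in> ?S"
    unfolding OPT_def using finite_objective_values[OF assms] by (intro Max_in)
  then show "\<exists>\<sigma>. item_sequence I \<sigma> \<and> objective I \<sigma> = OPT I" by auto
  show "objective I \<sigma>' \<le> OPT I" if "item_sequence I \<sigma>'"
    unfolding OPT_def using finite_objective_values[OF assms] that by (intro Max_ge) auto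
qed

end

theory Submission imports Defs begin

text \<open>
  Let \<open>G\<close> and \<open>O\<close> be the segments that the greedy sequence \<open>\<sigma>\<close> and an optimal sequence \<open>\<rho>\<close>
  offer to a function \<open>f\<close>. Monotonicity and submodularity bound \<open>f O \<le> f (G \<union> O)\<close> by \<open>f G\<close> plus
  the marginals of the items \<open>\<rho> t\<close> with respect to \<open>G\<close>, hence with respect to the smaller set of
  items that \<open>\<sigma>\<close> offered to \<open>f\<close> before step \<open>t\<close>. Summed over all functions active at step \<open>t\<close>,
  these marginals are at most those of \<open>\<sigma> t\<close>, because \<open>\<rho> t\<close> competed with \<open>\<sigma> t\<close> in the greedy
  choice; this uses that repetitions are allowed. The marginals of \<open>\<sigma>\<close> telescope, so they sum to
  at most the greedy objective.
\<close>

text \<open>\<open>submodular_on\<close> only speaks of \<open>v\<close> outside \<open>Y\<close>.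
  For \<open>v\<close> in \<open>Y\<close> the left side is \<open>0\<close>, and monotonicity makes
  the right side nonnegative.\<close>

lemma marginal_antimono:
  assumes "mono_on (Pow V) f" "submodular_on V f" "X \<subseteq> Y" "Y \<subseteq> V" "v \<in> V"
  shows "marginal f v Y \<le> marginal f v X"
proof (cases "v \<in> Y")
  case True
  have "f X \<le> f (X \<union> {v})"
    using assms by (intro mono_onD[OF assms(1)]) auto
  with True show ?thesis by (simp add: marginal_def insert_absorb)
next
  case False
  with assms show ?thesis by (auto simp: submodular_on_def)
qed

text \<open>Adding the items \<open>\<rho> t\<close> to \<open>Y\<close> one at a time, each gains
  at most its marginal at \<open>Y\<close>. An item already present is covered by
  \<open>marginal_antimono\<close>.\<close>

lemma submodular_union_le_sum_marginal:
  assumes "mono_on (Pow V) f" "submodular_on V f" "Y \<subseteq> V" "finite T" "\<rho> ` T \<subseteq> V"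
  shows "f (Y \<union> \<rho> ` T) \<le> f Y + (\<Sum>t\<in>T. marginal f (\<rho> t) Y)"
  using assms(4,5)
proof (induction T rule: finite_induct)
  case (insert t T)
  have "marginal f (\<rho> t) (Y \<union> \<rho> ` T) \<le> marginal f (\<rho> t) Y"
    using insert.prems assms by (intro marginal_antimono[OF assms(1,2)]) auto
  with insert show ?case by (simp add: marginal_def)
qed simp

lemma sum_marginal_telescope:
  fixes a n :: nat
  shows "(\<Sum>t\<in>{a..<n}. marginal f (\<sigma> t) (\<sigma> ` {a..<t})) = f (\<sigma> ` {a..<n}) - f {}"
proof (induction n)
  case (Suc n)
  then show ?case
    by (cases "a \<le> n") (simp_all add: marginal_def atLeastLessThanSuc)
qed simp

lemma submodular_sequence_le:
  fixes a n :: nat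
  assumes "mono_on (Pow V) f" "submodular_on V f"
    and \<rho>: "\<rho> ` {a..<n} \<subseteq> V" and \<sigma>: "\<sigma> ` {a..<n} \<subseteq> V"
  shows "f (\<rho> ` {a..<n}) \<le> f (\<sigma> ` {a..<n}) + (\<Sum>t\<in>{a..<n}. marginal f (\<rho> t) (\<sigma> ` {a..<t}))"
proof -
  have "f (\<rho> ` {a..<n}) \<le> f (\<sigma> ` {a..<n} \<union> \<rho> ` {a..<n})"
    using \<rho> \<sigma> by (intro mono_onD[OF assms(1)]) auto
  also have "\<dots> \<le> f (\<sigma> ` {a..<n}) + (\<Sum>t\<in>{a..<n}. marginal f (\<rho> t) (\<sigma> ` {a..<n}))"
    by (rule submodular_union_le_sum_marginal[OF assms(1,2) \<sigma> _ \<rho>]) simp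
  \<comment> \<open>Shrink the full segment to the prefix known when step \<open>t\<close> is
    decided.\<close>
  also have "(\<Sum>t\<in>{a..<n}. marginal f (\<rho> t) (\<sigma> ` {a..<n}))
      \<le> (\<Sum>t\<in>{a..<n}. marginal f (\<rho> t) (\<sigma> ` {a..<t}))"
    using \<rho> \<sigma> by (intro sum_mono marginal_antimono[OF assms(1,2)]) auto
  finally show ?thesis by simp
qed

text \<open>A negative deadline is truncated to \<open>0\<close>, which still gives the empty segment as \<open>a \<ge> 1\<close>.\<close>

lemma segment_eq_image:
  assumes "a \<ge> 1"
  shows "segment \<sigma> (int a) d = \<sigma> ` {a..<Suc (nat d)}"
  unfolding segment_def using assms by (intro arg_cong[where f = "image \<sigma>"]) auto

lemma segment_before_eq_image:
  assumes "a \<ge> 1"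
  shows "segment \<sigma> (int a) (int t - 1) = \<sigma> ` {a..<t}"
  unfolding segment_def using assms by (intro arg_cong[where f = "image \<sigma>"]) auto

lemma objective_eq_sum:
  assumes "msr_f I"
  shows "objective I \<sigma> =
    (\<Sum>f\<in>funs I. val I f (\<sigma> ` {arrival I f..<Suc (nat (deadline I f))}))"
proof -
  have "objective I \<sigma> =
      (\<Sum>t\<in>arrival I ` funs I. \<Sum>f\<in>{f \<in> funs I. arrival I f = t}.
        val I f (segment \<sigma> (int (arrival I f)) (deadline I f)))"
    by (simp add: objective_def arriving_def)
  also have "\<dots> = (\<Sum>f\<in>funs I. val I f (segment \<sigma> (int (arrival I f)) (deadline I f)))"
    using assms by (intro sum.image_gen[symmetric]) (simp add: msr_f_def)
  also have "\<dots> = (\<Sum>f\<in>funs I. val I f (\<sigma> ` {arrival I f..<Suc (nat (deadline I f))}))"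
    using assms by (intro sum.cong refl) (simp add: msr_f_def segment_eq_image)
  finally show ?thesis .
qed

text \<open>Double counting of the pairs of a step and a function active at it; used with
  \<open>\<rho>\<close> as competitor and with \<open>\<rho> = \<sigma>\<close>.\<close>

lemma sum_gain_eq:
  assumes "msr_f I" and N: "\<forall>f\<in>funs I. nat (deadline I f) \<le> N"
  shows "(\<Sum>t\<in>{1..N}. gain I \<sigma> t (\<rho> t)) =
    (\<Sum>f\<in>funs I. \<Sum>t\<in>{arrival I f..<Suc (nat (deadline I f))}.
      marginal (val I f) (\<rho> t) (\<sigma> ` {arrival I f..<t}))"
proof -
  have arr: "arrival I f \<ge> 1" if "f \<in> funs I" for f
    using assms(1) that by (simp add: msr_f_def)
  \<comment> \<open>Since \<open>t \<ge> 1\<close>, truncating a negative deadline to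
    \<open>0\<close> activates nothing.\<close>
  have act: "active I t = {f \<in> funs I. arrival I f \<le> t \<and> t \<le> nat (deadline I f)}"
    if "t \<in> {1..N}" for t
    using that arr by (auto simp: active_def arriving_def)
  have "(\<Sum>t\<in>{1..N}. gain I \<sigma> t (\<rho> t)) =
      (\<Sum>t\<in>{1..N}. \<Sum>f | f \<in> funs I \<and> (arrival I f \<le> t \<and> t \<le> nat (deadline I f)).
        marginal (val I f) (\<rho> t) (\<sigma> ` {arrival I f..<t}))"
    unfolding gain_def using arr
    by (intro sum.cong refl) (auto simp: act segment_before_eq_image)
  also have "\<dots> =
      (\<Sum>f\<in>funs I. \<Sum>t | t \<in> {1..N} \<and> (arrival I f \<le> t \<and> t \<le> nat (deadline I f)).
        marginal (val I f) (\<rho> t) (\<sigma> ` {arrival I f..<t}))"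
    using assms(1) by (intro sum.swap_restrict) (auto simp: msr_f_def)
  also have "\<dots> = (\<Sum>f\<in>funs I. \<Sum>t\<in>{arrival I f..<Suc (nat (deadline I f))}.
      marginal (val I f) (\<rho> t) (\<sigma> ` {arrival I f..<t}))"
    using arr N by (intro sum.cong refl) fastforce
  finally show ?thesis .
qed

lemma greedy_objective_ge_half:
  assumes I: "msr_f I" and greedy: "greedy_sequence I \<sigma>" and \<rho>: "item_sequence I \<rho>"
  shows "objective I \<rho> \<le> 2 * objective I \<sigma>"
proof -
  \<comment> \<open>A common horizon; the \<open>0\<close> keeps \<open>Max\<close> meaningful when
    \<open>funs I\<close> is empty.\<close>
  define N where "N = Max (insert 0 ((\<lambda>f. nat (deadline I f)) ` funs I))"
  have fin: "finite (funs I)" using I by (simp add: msr_f_def)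
  have N: "\<forall>f\<in>funs I. nat (deadline I f) \<le> N"
    unfolding N_def using fin by (auto intro: Max_ge)
  define n where "n f = Suc (nat (deadline I f))" for f
  have \<sigma>: "item_sequence I \<sigma>"
    using greedy by (simp add: greedy_sequence_def item_sequence_def is_arg_max_def)
  have sub: "s ` {arrival I f..<n f} \<subseteq> items I" if "f \<in> funs I" "item_sequence I s" for f s
    using that I by (fastforce simp: msr_f_def item_sequence_def)
  have "objective I \<rho> \<le> (\<Sum>f\<in>funs I. val I f (\<sigma> ` {arrival I f..<n f}) +
      (\<Sum>t\<in>{arrival I f..<n f}. marginal (val I f) (\<rho> t) (\<sigma> ` {arrival I f..<t})))"
    unfolding objective_eq_sum[OF I] n_def[symmetric]
    using I by (intro sum_mono submodular_sequence_le[where V = "items I"] sub \<rho> \<sigma>)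
      (auto simp: msr_f_def)
  also have "\<dots> = objective I \<sigma> + (\<Sum>t\<in>{1..N}. gain I \<sigma> t (\<rho> t))"
    by (simp only: sum.distrib objective_eq_sum[OF I] sum_gain_eq[OF I N] n_def)
  also have "(\<Sum>t\<in>{1..N}. gain I \<sigma> t (\<rho> t)) \<le> (\<Sum>t\<in>{1..N}. gain I \<sigma> t (\<sigma> t))"
    using greedy \<rho>
    by (intro sum_mono)
      (auto simp: greedy_sequence_def item_sequence_def is_arg_max_def not_less)
  also have "\<dots> = (\<Sum>f\<in>funs I. val I f (\<sigma> ` {arrival I f..<n f}) - val I f {})"
    by (simp only: sum_gain_eq[OF I N] sum_marginal_telescope n_def)
  \<comment> \<open>Drop \<open>val I f {}\<close>, which is nonnegative.\<close>
  also have "\<dots> \<le> objective I \<sigma>"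
    unfolding objective_eq_sum[OF I] n_def[symmetric]
    using I by (intro sum_mono) (auto simp: msr_f_def)
  finally show ?thesis by simp
qed

theorem theorem4p2:
  fixes I :: "('a, 'f) msr_instance" and \<sigma> :: "nat \<Rightarrow> 'a"
  assumes "msr_f I" and "greedy_sequence I \<sigma>"
  shows "objective I \<sigma> \<ge> 1 / 2 * OPT I"
proof -
  obtain \<rho> where "item_sequence I \<rho>" "objective I \<rho> = OPT I"
    using OPT_attained(1)[OF assms(1)] by blast
  with greedy_objective_ge_half[OF assms] show ?thesis by fastforce
qed

end
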